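(* Let $x\in\mathbb{C}$, $x\neq 1$, $a\in\mathbb{C}$ and let $n$ be a positive integer. Let $C_n^a$ denote the Charlier polynomial and, for $k=0,1,2,\ldots$, define $$\Phi_k(x,n)=\frac{\Gamma(nx+1)}{\Gamma(nx-n+1)}\,\frac{1}{(1-x)^k}\;{}_2F_1(-k,-n;\,nx-n+1;\,1-x),$$ so that in particular $$\Phi_0(x,n)=\frac{\Gamma(nx+1)}{\Gamma(nx+1-n)},\qquad \Phi_1(x,n)=\frac{\Phi_0(x,n)}{(1-x)(n(x-1)+1)}.$$ Then: (i) $$C_n^a(xn)=e^{a/(1-x)}\sum_{k=0}^\infty\frac{(-a)^k}{k!}\,\Phi_k(x,n),$$ the series being convergent. (ii) The sequence $\{\Phi_k(x,n)\}_{k\ge 0}$ satisfies, for $k=2,3,\ldots$ (with $n(x-1)+k\ne0$), $$\Phi_k(x,n)=\frac{1}{n(x-1)+k}\left[\frac{x(1-k)-k}{x-1}\,\Phi_{k-1}(x,n)+\frac{x(1-k)}{(x-1)^2}\,\Phi_{k-2}(x,n)\right].$$ (iii) The sequence $\{\Phi_k(x,n)\}_{k\ge0}$ is an asymptotic sequence for large $n$ in the following sense: for each fixed $k$, $$\Phi_k(x,n)=\mathcal{O}\!\left(n^{-\lfloor (k+1)/2\rfloor}\,(n|x|)_n\right)\qquad\text{as } n\to\infty,$$ and for every $\delta>0$ this holds uniformly with respect to complex $x$ with $|x-1|\ge\delta$.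
   Context: The Charlier polynomials $C_n^a(x)$ are defined by the generating function $e^{-aw}(1+w)^{x}=\sum_{n=0}^\infty C_n^a(x)\,\frac{w^n}{n!}$ ($|w|<1$, principal branch), equivalently $C_n^a(x)=\sum_{k=0}^n\binom{n}{k}\binom{x}{k}k!\,(-a)^{n-k}$. $(b)_n$ is the Pochhammer symbol: $(b)_0=1$, $(b)_n=b(b+1)\cdots(b+n-1)$. $\lfloor\cdot\rfloor$ is the integer part. ${}_2F_1$ is the Gauss hypergeometric function (here a terminating sum). The quotient $\Gamma(nx+1)/\Gamma(nx-n+1)$ is the polynomial $nx(nx-1)\cdots(nx-n+1)$. At values of $x$ where $nx-n+1$ is a non-positive integer, the formula for $\Phi_k(x,n)$ (and the quotient formula for $\Phi_1(x,n)$) is understood by continuity in $x$; explicitly, for all $x\ne 1$, $\Phi_k(x,n)=n!\sum_{j=0}^{\min(k,n)}\binom{k}{j}(1-x)^{j-k}\binom{nx}{n-j}$. *)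

theory Defs
  imports "HOL-Complex_Analysis.Complex_Analysis"
begin

text \<open>
  The sequence of Charlier polynomials (as values at a fixed point \<open>x\<close>) is the unique
  sequence with the defining generating function; \<open>powr\<close> is the principal branch.
  Existence and uniqueness are lemmas \<open>charlier_sums\<close> and \<open>charlier_unique\<close> below.
\<close>

definition charlier :: "complex \<Rightarrow> complex \<Rightarrow> nat \<Rightarrow> complex" where
  "charlier a x = (THE c. \<forall>w. norm w < 1 \<longrightarrow>
     (\<lambda>n. c n * (w ^ n / fact n)) sums (exp (- a * w) * (1 + w) powr x))"

definition hyp2F1 :: "complex \<Rightarrow> complex \<Rightarrow> complex \<Rightarrow> complex \<Rightarrow> complex" where
  "hyp2F1 a b c z = eval_fps (fps_hypergeo [a, b] [c] 1) z"

text \<open>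
  The formula for \<open>\<Phi>\<^sub>k(x,n)\<close>. It is meaningful in HOL only if \<open>nx - n + 1\<close> is not a
  non-positive integer (then \<open>nx + 1\<close> is not one either); at the other points
  \<open>x \<noteq> 1\<close>, which are isolated, \<open>Phi\<close> is the limit of the formula.
\<close>

definition Phi_formula :: "nat \<Rightarrow> complex \<Rightarrow> nat \<Rightarrow> complex" where
  "Phi_formula k x n =
     Gamma (of_nat n * x + 1) / Gamma (of_nat n * x - of_nat n + 1)
     * (1 / (1 - x) ^ k)
     * hyp2F1 (- of_nat k) (- of_nat n) (of_nat n * x - of_nat n + 1) (1 - x)"

definition Phi :: "nat \<Rightarrow> complex \<Rightarrow> nat \<Rightarrow> complex" where
  "Phi k x n =
     (if of_nat n * x - of_nat n + 1 \<in> \<int>\<^sub>\<le>\<^sub>0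
      then Lim (at x) (\<lambda>y. Phi_formula k y n)
      else Phi_formula k x n)"

lemma charlier_coeff_unique:
  assumes "\<forall>w. norm w < 1 \<longrightarrow> (\<lambda>n. c n * (w ^ n / fact n)) sums f w"
  shows "c n = (deriv ^^ n) f (0::complex)"
proof -
  define F where "F = Abs_fps (\<lambda>n. c n / fact n)"
  have s: "(\<lambda>n. fps_nth F n * w ^ n) sums f w" if "norm w < 1" for w
    using assms that by (simp add: F_def)
  have "fps_conv_radius F \<ge> 1"
    unfolding fps_conv_radius_def
  proof (rule conv_radius_geI_ex)
    fix r :: real assume "0 < r" "ereal r < 1"
    then show "\<exists>z. norm z = r \<and> summable (\<lambda>n. fps_nth F n * z ^ n)"
      using s[of "of_real r"] by (intro exI[of _ "of_real r"]) (auto simp: sums_iff)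
  qed
  moreover have "eventually (\<lambda>z. eval_fps F z = f z) (nhds 0)"
  proof (rule eventually_nhds_in_open[THEN eventually_mono])
    show "open (ball (0::complex) 1)" "0 \<in> ball (0::complex) 1" by auto
    show "eval_fps F z = f z" if "z \<in> ball 0 1" for z
      using s[of z] that by (auto simp: eval_fps_def sums_iff)
  qed
  ultimately have "f has_fps_expansion F"
    by (auto simp: has_fps_expansion_def intro: less_le_trans[of 0 "1::ereal"])
  from fps_nth_fps_expansion[OF this, of n] show ?thesis
    by (simp add: F_def)
qed

lemma charlier_explicit_sums:
  assumes "norm w < 1"
  shows "(\<lambda>n. (\<Sum>k\<le>n. of_nat (n choose k) * (x gchoose k) * fact k * (- a) ^ (n - k)) *
           (w ^ n / fact n)) sums (exp (- a * w) * (1 + w) powr (x::complex))"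
proof -
  obtain r where r: "norm w < r" "r < 1" using assms dense by blast
  have "summable (\<lambda>n. (x gchoose n) * of_real r ^ n)"
    using gen_binomial_complex[of "of_real r" x] r norm_ge_zero[of w]
    by (simp add: sums_iff del: norm_ge_zero)
  then have 1: "summable (\<lambda>n. norm ((x gchoose n) * w ^ n))"
    using r norm_ge_zero[of w] by (intro powser_insidea[of _ "of_real r"]) (auto simp del: norm_ge_zero)
  have 2: "summable (\<lambda>n. norm ((- a * w) ^ n /\<^sub>R fact n))"
    by (rule summable_norm_exp)
  have "(\<lambda>n. \<Sum>k\<le>n. ((x gchoose k) * w ^ k) * ((- a * w) ^ (n - k) /\<^sub>R fact (n - k)))
      sums ((1 + w) powr x * exp (- a * w))"
    using Cauchy_product_sums[OF 1 2] gen_binomial_complex[OF assms, of x]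
      exp_converges[of "- a * w"]
    by (simp add: sums_iff)
  also have "(\<lambda>n. \<Sum>k\<le>n. ((x gchoose k) * w ^ k) * ((- a * w) ^ (n - k) /\<^sub>R fact (n - k))) =
      (\<lambda>n. (\<Sum>k\<le>n. of_nat (n choose k) * (x gchoose k) * fact k * (- a) ^ (n - k)) *
           (w ^ n / fact n))"
  proof
    fix n
    have "((x gchoose k) * w ^ k) * ((- a * w) ^ (n - k) /\<^sub>R fact (n - k)) =
        of_nat (n choose k) * (x gchoose k) * fact k * (- a) ^ (n - k) * (w ^ n / fact n)"
      if "k \<le> n" for k
    proof -
      have w: "w ^ k * w ^ (n - k) = w ^ n" using that by (simp flip: power_add)
      have "((x gchoose k) * w ^ k) * ((- a * w) ^ (n - k) /\<^sub>R fact (n - k)) =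
         (x gchoose k) * (- a) ^ (n - k) * (w ^ k * w ^ (n - k)) / fact (n - k)"
        unfolding power_mult_distrib[of "- a" w]
        by (simp add: scaleR_conv_of_real divide_simps mult_ac)
      then show ?thesis
        unfolding w using that by (simp add: binomial_fact divide_simps mult_ac)
    qed
    then show "(\<Sum>k\<le>n. ((x gchoose k) * w ^ k) * ((- a * w) ^ (n - k) /\<^sub>R fact (n - k))) =
      (\<Sum>k\<le>n. of_nat (n choose k) * (x gchoose k) * fact k * (- a) ^ (n - k)) * (w ^ n / fact n)"
      unfolding sum_distrib_right by (intro sum.cong) auto
  qed
  finally show ?thesis by (simp add: mult.commute)
qed

lemma charlier_unique:
  assumes "\<forall>w. norm w < 1 \<longrightarrow> (\<lambda>n. c n * (w ^ n / fact n)) sums (exp (- a * w) * (1 + w) powr x)"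
  shows "charlier a x = c"
  unfolding charlier_def
proof (rule the_equality)
  show "\<forall>w. norm w < 1 \<longrightarrow> (\<lambda>n. c n * (w ^ n / fact n)) sums (exp (- a * w) * (1 + w) powr x)"
    by (rule assms)
next
  fix d assume "\<forall>w. norm w < 1 \<longrightarrow> (\<lambda>n. d n * (w ^ n / fact n)) sums (exp (- a * w) * (1 + w) powr x)"
  from charlier_coeff_unique[OF this] charlier_coeff_unique[OF assms] show "d = c" by auto
qed

lemma charlier_explicit:
  "charlier a x n = (\<Sum>k\<le>n. of_nat (n choose k) * (x gchoose k) * fact k * (- a) ^ (n - k))"
  by (subst charlier_unique[where c = "\<lambda>n. \<Sum>k\<le>n. of_nat (n choose k) * (x gchoose k) * fact k * (- a) ^ (n - k)"])
     (use charlier_explicit_sums in auto)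

lemma charlier_sums:
  assumes "norm w < 1"
  shows "(\<lambda>n. charlier a x n * (w ^ n / fact n)) sums (exp (- a * w) * (1 + w) powr x)"
  unfolding charlier_explicit by (rule charlier_explicit_sums[OF assms])

lemma hyp2F1_terminating:
  "hyp2F1 (- of_nat k) b c z =
     (\<Sum>j\<le>k. pochhammer (- of_nat k) j * pochhammer b j / (pochhammer c j * fact j) * z ^ j)"
  unfolding hyp2F1_def eval_fps_def
  by (subst suminf_finite[where N = "{..k}"])
     (auto simp: pochhammer_eq_0_iff)

lemma Phi_formula_explicit:
  assumes "x \<noteq> 1" "of_nat n * x - of_nat n + 1 \<notin> \<int>\<^sub>\<le>\<^sub>0"
  shows "Phi_formula k x n =
    fact n * (\<Sum>j\<le>min k n. of_nat (k choose j) * (1 / (1 - x) ^ (k - j)) * ((of_nat n * x) gchoose (n - j)))"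
proof -
  define c where "c = of_nat n * x - of_nat n + 1"
  have cn: "of_nat n * x + 1 = c + of_nat n" by (simp add: c_def)
  have Gam: "Gamma (of_nat n * x + 1) / Gamma c = pochhammer c n"
    using pochhammer_Gamma[of c n] assms unfolding cn c_def[symmetric] by simp
  have nz: "pochhammer c j \<noteq> 0" for j
    using assms(2) unfolding c_def[symmetric] pochhammer_eq_0_iff
    by auto
  have smd: "pochhammer c n * (1 / (1 - x) ^ k) *
      (pochhammer (- of_nat k) j * pochhammer (- of_nat n) j / (pochhammer c j * fact j) * (1 - x) ^ j) =
      fact n * (of_nat (k choose j) * (1 / (1 - x) ^ (k - j)) * ((of_nat n * x) gchoose (n - j)))"
    if "j \<le> k" "j \<le> n" for j
  proof -
    have p: "pochhammer (- of_nat m) j = (- 1) ^ j * (fact m / fact (m - j) :: complex)"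
      if "j \<le> m" for m
    proof -
      have "(-1) ^ j * pochhammer (- of_nat m) j / fact j = (of_nat (m choose j) :: complex)"
        by (simp add: binomial_gbinomial gbinomial_pochhammer)
      then have "(-1) ^ j * ((-1) ^ j * pochhammer (- of_nat m) j) =
          (-1) ^ j * (fact j * of_nat (m choose j) :: complex)"
        by (simp add: field_simps)
      then show ?thesis using that
        by (simp add: binomial_fact mult.assoc[symmetric] flip: power_mult_distrib)
    qed
    have q: "pochhammer c n = pochhammer c j * pochhammer (c + of_nat j) (n - j)"
      using pochhammer_product[OF that(2), of c] .
    have g: "(of_nat n * x) gchoose (n - j) = pochhammer (c + of_nat j) (n - j) / fact (n - j)"
      using that by (simp add: gbinomial_pochhammer' c_def of_nat_diff algebra_simps)
    have xk: "(1 - x) ^ k = (1 - x) ^ j * (1 - x) ^ (k - j)"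
      using that by (simp flip: power_add)
    have sg: "(-1) ^ j * (-1) ^ j = (1::complex)" by simp
    show ?thesis
      unfolding p[OF that(1)] p[OF that(2)] q g xk
      using that assms(1) nz[of j] sg by (simp add: binomial_fact divide_simps)
  qed
  have "Phi_formula k x n = (\<Sum>j\<le>k. pochhammer c n * (1 / (1 - x) ^ k) *
      (pochhammer (- of_nat k) j * pochhammer (- of_nat n) j / (pochhammer c j * fact j) * (1 - x) ^ j))"
    unfolding Phi_formula_def c_def[symmetric] Gam hyp2F1_terminating sum_distrib_left ..
  also have "\<dots> = (\<Sum>j\<le>min k n. pochhammer c n * (1 / (1 - x) ^ k) *
      (pochhammer (- of_nat k) j * pochhammer (- of_nat n) j / (pochhammer c j * fact j) * (1 - x) ^ j))"
    by (rule sum.mono_neutral_right) (auto simp: pochhammer_of_nat_eq_0_iff)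
  also have "\<dots> = (\<Sum>j\<le>min k n.
      fact n * (of_nat (k choose j) * (1 / (1 - x) ^ (k - j)) * ((of_nat n * x) gchoose (n - j))))"
    by (rule sum.cong) (auto simp only: smd atMost_iff min.bounded_iff)
  finally show ?thesis unfolding sum_distrib_left .
qed

text \<open>The continuity convention yields the explicit polynomial expression.\<close>

lemma Phi_explicit:
  assumes "x \<noteq> 1" "n > 0"
  shows "Phi k x n =
    fact n * (\<Sum>j\<le>min k n. of_nat (k choose j) * (1 / (1 - x) ^ (k - j)) * ((of_nat n * x) gchoose (n - j)))"
proof (cases "of_nat n * x - of_nat n + 1 \<in> \<int>\<^sub>\<le>\<^sub>0")
  case False
  then show ?thesis using Phi_formula_explicit[OF assms(1) False] by (simp add: Phi_def)
next
  case True
  define E where "E = (\<lambda>y. fact n * (\<Sum>j\<le>min k n. of_nat (k choose j) * (1 / (1 - y) ^ (k - j)) *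
     ((of_nat n * y) gchoose (n - j))) :: complex)"
  have "isCont E x"
    unfolding E_def gbinomial_prod_rev using assms by (intro continuous_intros) auto
  then have lim: "(E \<longlongrightarrow> E x) (at x)" by (simp add: isCont_def)
  have "eventually (\<lambda>y. y \<noteq> 1 \<and> of_nat n * y - of_nat n + 1 \<notin> \<int>\<^sub>\<le>\<^sub>0) (at x)"
    unfolding eventually_at
  proof (intro exI[of _ "min (norm (x - 1)) (1 / real n)"] conjI ballI impI)
    show "0 < min (norm (x - 1)) (1 / real n)" using assms by simp
    fix y assume y: "y \<noteq> x \<and> dist y x < min (norm (x - 1)) (1 / real n)"
    then show "y \<noteq> 1" by (auto simp: dist_norm norm_minus_commute)
    show "of_nat n * y - of_nat n + 1 \<notin> \<int>\<^sub>\<le>\<^sub>0"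
    proof
      assume "of_nat n * y - of_nat n + 1 \<in> \<int>\<^sub>\<le>\<^sub>0"
      then obtain p where p: "of_nat n * y - of_nat n + 1 = of_int p"
        by (auto elim!: nonpos_Ints_cases)
      from True obtain q where q: "of_nat n * x - of_nat n + 1 = of_int q"
        by (auto elim!: nonpos_Ints_cases)
      have d: "of_nat n * (y - x) = of_int (p - q)" using arg_cong2[OF p q, of minus] by (simp add: algebra_simps)
      have "norm (of_nat n * (y - x)) < 1"
        unfolding norm_mult using y assms
        by (simp add: dist_norm pos_less_divide_eq mult.commute)
      then have "p = q" unfolding d norm_of_int by linarith
      then show False using d y assms by simp
    qed
  qed
  then have ev: "eventually (\<lambda>y. Phi_formula k y n = E y) (at x)"
    by eventually_elim (simp add: Phi_formula_explicit E_def)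
  have "((\<lambda>y. Phi_formula k y n) \<longlongrightarrow> E x) (at x)"
    by (rule Lim_transform_eventually[OF lim]) (use ev in eventually_elim, simp)
  then have "Lim (at x) (\<lambda>y. Phi_formula k y n) = E x" by (intro tendsto_Lim) auto
  then show ?thesis using True by (simp add: Phi_def E_def)
qed

end

theory Submission
  imports Defs
begin

text \<open>
  \<open>\<Phi>\<^sub>k(x,n)/n!\<close> is the coefficient of \<open>w\<^sup>n\<close> in \<open>(1 + w)\<^bsup>nx\<^esup> (w + 1/(1-x))\<^sup>k\<close>. Summing
  the explicit form against \<open>(-a)\<^sup>k/k!\<close> term by term turns each binomial \<open>k choose j\<close> into
  \<open>(-a)\<^sup>j/j! e\<^bsup>-a/(1-x)\<^esup>\<close>, which gives (i); differentiating the generating function gives (ii).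
  Because the exponent is \<open>nx\<close>, the terms of order \<open>n\<close> in the coefficient of \<open>\<Phi>\<^bsub>k-1\<^esub>\<close> cancel,
  and so for \<open>\<bar>x - 1\<bar> \<ge> \<delta>\<close> the coefficients of \<open>\<Phi>\<^bsub>k-1\<^esub>\<close> and \<open>\<Phi>\<^bsub>k-2\<^esub>\<close> are bounded, while that of
  \<open>\<Phi>\<^sub>k\<close> is at least \<open>n \<delta>/2\<close> eventually. Hence \<open>\<Phi>\<^sub>k\<close> is smaller than its two predecessors by a factor
  \<open>1/n\<close>, and (iii) follows by induction, starting from \<open>\<bar>nx - i\<bar> \<le> n \<bar>x\<bar> + i\<close> for \<open>k = 0\<close>.
\<close>

lemma pochhammer_real_nonneg: "r \<ge> 0 \<Longrightarrow> pochhammer r n \<ge> 0" for r :: real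
  unfolding pochhammer_prod by (intro prod_nonneg) auto

section \<open>The generating function and the recurrence it yields\<close>

text \<open>Multiplying by \<open>fps_X ^ j\<close> shifts coefficients by \<open>j\<close>, so
  expanding the \<open>k\<close>-th power binomially gives the explicit sum; terms with
  \<open>j > n\<close> contribute nothing in degree \<open>n\<close>, whence
  \<open>min k n\<close>.\<close>

lemma Phi_eq_fps_nth:
  assumes "x \<noteq> 1" "n > 0"
  shows "Phi k x n = fact n *
    fps_nth (fps_binomial (of_nat n * x) * (fps_X + fps_const (1 / (1 - x))) ^ k) n"
proof -
  define v where "v = 1 / (1 - x)"
  have pow: "(fps_X + fps_const v) ^ k =
      (\<Sum>j\<le>k. fps_const (of_nat (k choose j) * v ^ (k - j)) * fps_X ^ j)"
    unfolding binomial_ring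
    by (intro sum.cong refl) (simp add: fps_const_power fps_of_nat [symmetric] mult_ac
        del: fps_const_mult flip: fps_const_mult)
  have "fps_nth (fps_binomial (of_nat n * x) * (fps_X + fps_const v) ^ k) n =
      (\<Sum>j\<le>k. of_nat (k choose j) * v ^ (k - j) *
        (if n < j then 0 else (of_nat n * x) gchoose (n - j)))"
    unfolding pow sum_distrib_left fps_sum_nth
    by (intro sum.cong refl) (simp add: fps_X_power_mult_right_nth mult.left_commute[of "fps_binomial _"])
  also have "\<dots> = (\<Sum>j\<le>min k n. of_nat (k choose j) * v ^ (k - j) * ((of_nat n * x) gchoose (n - j)))"
    by (rule sum.mono_neutral_cong_right) auto
  finally show ?thesis
    using Phi_explicit[OF assms, of k] by (simp add: v_def power_one_over)
qed

text \<open>Extracting the coefficient of \<open>X\<^sup>n\<close> in \<open>X G' = n G\<close> for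
  \<open>G = (1 + X)\<^bsup>nx+1\<^esup> (X + 1/(1-x))\<^sup>j\<close> gives the three-term recurrence.\<close>

lemma Phi_recurrence:
  assumes "x \<noteq> 1" "n > 0"
  shows "(of_nat n * (x - 1) + of_nat (Suc j)) * Phi (Suc j) x n =
    (x * of_nat j + of_nat (Suc j)) / (1 - x) * Phi j x n
      - x * of_nat j / (1 - x)\<^sup>2 * Phi (j - 1) x n"
proof -
  define N where "N = of_nat n * x"
  define v where "v = 1 / (1 - x)"
  define B where "B = fps_binomial N"
  define T where "T = fps_X + fps_const v"
  define I where "I = (\<lambda>k. fps_nth (B * T ^ k) n)"
  have Phi: "Phi k x n = fact n * I k" for k
    using Phi_eq_fps_nth[OF assms] by (simp add: I_def B_def T_def N_def v_def)
  have nz: "(1 + fps_X :: complex fps) $ 0 \<noteq> 0" by simp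
  have dB: "(1 + fps_X) * fps_deriv B = fps_const N * B"
    unfolding B_def fps_binomial_deriv by (simp add: fps_divide_unit nz inverse_mult_eq_1' mult_ac)
  have dT: "fps_deriv T = 1" by (simp add: T_def)
  have X: "fps_X = T - fps_const v" by (simp add: T_def)
  \<comment> \<open>The factor \<open>1 + fps_X\<close> cancels the denominator of
    \<open>fps_deriv B\<close>; once \<open>fps_X\<close> is rewritten as
    \<open>T - fps_const v\<close>, only multiples of series \<open>B * T ^ i\<close>
    remain.\<close>
  define G where "G = (1 + fps_X) * B * T ^ j"
  have "fps_deriv G = B * T ^ j + ((1 + fps_X) * fps_deriv B) * T ^ j
      + (1 + fps_X) * B * (of_nat j * T ^ (j - 1))"
    unfolding G_def by (simp add: fps_deriv_power dT algebra_simps fps_of_nat)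
  then have "fps_deriv G = B * T ^ j + (fps_const N * B) * T ^ j
      + (1 + fps_X) * B * (of_nat j * T ^ (j - 1))"
    unfolding dB .
  then have "fps_X * fps_deriv G = fps_X * (fps_const (N + 1) * B * T ^ j)
      + fps_X * (1 + fps_X) * B * (of_nat j * T ^ (j - 1))"
    by (simp add: algebra_simps flip: fps_const_add)
  also have "\<dots> = fps_const (N + 1) * (B * T ^ Suc j) - fps_const (v * (N + 1)) * (B * T ^ j)
      + fps_const (of_nat j) * (B * T ^ Suc j) + fps_const (of_nat j * (1 - 2 * v)) * (B * T ^ j)
      - fps_const (of_nat j * v * (1 - v)) * (B * T ^ (j - 1))"
  proof -
    \<comment> \<open>Arbitrary series \<open>V\<close> and \<open>W\<close> make this a pure ring
      identity. At \<open>j = 0\<close> the truncated \<open>j - 1\<close> is harmless because of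
      the factor \<open>of_nat j\<close>.\<close>
    have "(T - V) * ((W + 1) * B * T ^ j) + (T - V) * (1 + (T - V)) * B * (of_nat j * T ^ (j - 1))
      = (W + 1) * (B * T ^ Suc j) - V * (W + 1) * (B * T ^ j)
      + of_nat j * (B * T ^ Suc j) + of_nat j * (1 - 2 * V) * (B * T ^ j)
      - of_nat j * V * (1 - V) * (B * T ^ (j - 1))" for V W
      by (cases j) (simp_all add: algebra_simps)
    from this[of "fps_const v" "fps_const N"] show ?thesis
      by (simp add: X fps_of_nat [symmetric] numeral_fps_const flip: fps_const_add fps_const_mult fps_const_sub)
  qed
  finally have XG: "fps_nth (fps_X * fps_deriv G) n = (N + 1) * I (Suc j) - v * (N + 1) * I j
      + of_nat j * I (Suc j) + of_nat j * (1 - 2 * v) * I j - of_nat j * v * (1 - v) * I (j - 1)"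
    by (simp add: I_def fps_mult_left_const_nth)
  have XG': "fps_nth (fps_X * fps_deriv G) n = of_nat n * fps_nth G n"
    using assms by (simp add: fps_X_mult_nth)
  have "G = B * T ^ Suc j + fps_const (1 - v) * (B * T ^ j)"
    unfolding G_def X by (simp add: algebra_simps flip: fps_const_sub)
  then have "fps_nth G n = I (Suc j) + (1 - v) * I j"
    by (simp add: I_def)
  with XG XG' have "of_nat n * (I (Suc j) + (1 - v) * I j) = (N + 1) * I (Suc j) - v * (N + 1) * I j
      + of_nat j * I (Suc j) + of_nat j * (1 - 2 * v) * I j - of_nat j * v * (1 - v) * I (j - 1)"
    by (simp only:)
  then have "(N - of_nat n + of_nat (Suc j)) * I (Suc j) =
      (v * (N + 1) - of_nat j * (1 - 2 * v) + of_nat n * (1 - v)) * I j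
      + of_nat j * (v * (1 - v)) * I (j - 1)"
    by (simp add: algebra_simps)
  \<comment> \<open>The terms of order \<open>n\<close> cancel here: \<open>v * (1 - x) = 1\<close>
    gives \<open>v * x = v - 1\<close>, hence \<open>v * N + of_nat n * (1 - v) = 0\<close>.\<close>
  also have "v * (N + 1) - of_nat j * (1 - 2 * v) + of_nat n * (1 - v) =
      v * (x * of_nat j + (of_nat j + 1))"
  proof -
    have "v * (1 - x) = 1" using assms by (simp add: v_def)
    then show ?thesis unfolding N_def by algebra
  qed
  also have "v * (x * of_nat j + (of_nat j + 1)) = (x * of_nat j + of_nat (Suc j)) / (1 - x)"
    by (simp add: v_def)
  also have "of_nat j * (v * (1 - v)) = - (x * of_nat j / (1 - x)\<^sup>2)"
    using assms by (simp add: v_def divide_simps power2_eq_square)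
  also have "N - of_nat n + of_nat (Suc j) = of_nat n * (x - 1) + of_nat (Suc j)"
    by (simp add: N_def algebra_simps)
  finally have eq: "(of_nat n * (x - 1) + of_nat (Suc j)) * I (Suc j) =
      (x * of_nat j + of_nat (Suc j)) / (1 - x) * I j + - (x * of_nat j / (1 - x)\<^sup>2) * I (j - 1)" .
  have "A * (F * p) = c * (F * q) - d * (F * r)" if "A * p = c * q + - d * r" for A F c d p q r :: complex
    using that by algebra
  from this[OF eq] show ?thesis unfolding Phi .
qed

section \<open>Special values and the solved recurrence\<close>

lemma Phi_0:
  assumes "x \<noteq> 1" "n > 0"
  shows "Phi 0 x n = (\<Prod>i<n. of_nat n * x - of_nat i)"
  using Phi_explicit[OF assms, of 0] by (simp add: gbinomial_prod_rev atLeast0LessThan)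

lemma Phi_0_Gamma:
  assumes "of_nat n * x - of_nat n + 1 \<notin> \<int>\<^sub>\<le>\<^sub>0"
  shows "Phi 0 x n = Gamma (of_nat n * x + 1) / Gamma (of_nat n * x + 1 - of_nat n)"
proof -
  have "hyp2F1 (- of_nat 0) b c z = 1" for b c z :: complex
    unfolding hyp2F1_terminating by simp
  then show ?thesis
    using assms by (simp add: Phi_def Phi_formula_def algebra_simps)
qed

lemma Phi_1:
  assumes "x \<noteq> 1" "n > 0" "of_nat n * (x - 1) + 1 \<noteq> 0"
  shows "Phi 1 x n = Phi 0 x n / ((1 - x) * (of_nat n * (x - 1) + 1))"
proof -
  have "(of_nat n * (x - 1) + 1) * Phi 1 x n = Phi 0 x n / (1 - x)"
    using Phi_recurrence[OF assms(1,2), of 0] by simp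
  then show ?thesis using assms(1,3) by (simp add: eq_divide_eq mult_ac)
qed

lemma isCont_Phi:
  assumes "x \<noteq> 1" "n > 0"
  shows "isCont (\<lambda>y. Phi k y n) x"
proof -
  let ?E = "\<lambda>y. fact n * (\<Sum>j\<le>min k n. of_nat (k choose j) * (1 / (1 - y) ^ (k - j)) *
     ((of_nat n * y) gchoose (n - j))) :: complex"
  have "isCont ?E x"
    unfolding gbinomial_prod_rev using assms by (intro continuous_intros) auto
  moreover have "eventually (\<lambda>y. y \<noteq> 1) (nhds x)"
    using assms by (intro eventually_nhds_in_open[of "- {1}", simplified]) auto
  then have "eventually (\<lambda>y. Phi k y n = ?E y) (nhds x)"
    by eventually_elim (use assms in \<open>simp add: Phi_explicit\<close>)
  ultimately show ?thesis by (subst isCont_cong)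
qed

text \<open>At \<open>x = 1 - 1 / n\<close> the quotient has denominator zero, and this limit is its
  meaning there. It follows from \<open>Phi_1\<close> at nearby points and the continuity of
  \<open>Phi 1\<close>.\<close>

lemma Phi_1_tendsto:
  assumes "x \<noteq> 1" "n > 0"
  shows "((\<lambda>y. Phi 0 y n / ((1 - y) * (of_nat n * (y - 1) + 1))) \<longlongrightarrow> Phi 1 x n) (at x)"
proof (rule Lim_transform_eventually)
  show "((\<lambda>y. Phi 1 y n) \<longlongrightarrow> Phi 1 x n) (at x)"
    using isCont_Phi[OF assms] by (simp add: isCont_def)
  have "eventually (\<lambda>y. y \<noteq> 1) (at x)"
    using assms by (intro eventually_neq_at_within)
  \<comment> \<open>The excluded value is the zero of \<open>of_nat n * (y - 1) + 1\<close>; the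
    punctured neighbourhood avoids it even when \<open>x\<close> equals it.\<close>
  moreover have "eventually (\<lambda>y. y \<noteq> 1 - 1 / of_nat n) (at x)"
    by (rule eventually_neq_at_within)
  ultimately show "eventually (\<lambda>y. Phi 1 y n = Phi 0 y n / ((1 - y) * (of_nat n * (y - 1) + 1))) (at x)"
  proof eventually_elim
    case (elim y)
    have "of_nat n * (y - 1) + 1 \<noteq> 0"
      using elim(2) assms(2) by (auto simp: field_simps)
    then show ?case using Phi_1 elim(1) assms(2) by blast
  qed
qed

lemma Phi_recurrence_solved:
  assumes "x \<noteq> 1" "n > 0" "k \<ge> 2" "of_nat n * (x - 1) + of_nat k \<noteq> 0"
  shows "Phi k x n = 1 / (of_nat n * (x - 1) + of_nat k) *
         ((x * (1 - of_nat k) - of_nat k) / (x - 1) * Phi (k - 1) x n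
          + x * (1 - of_nat k) / (x - 1)\<^sup>2 * Phi (k - 2) x n)"
proof -
  obtain j where k: "k = Suc j" using assms(3) by (cases k) auto
  have "(x * (1 - of_nat k) - of_nat k) / (x - 1) = (x * of_nat j + of_nat (Suc j)) / (1 - x)"
    using assms(1) by (simp add: k divide_simps) (simp add: algebra_simps)
  moreover have "x * (1 - of_nat k) / (x - 1)\<^sup>2 = - (x * of_nat j / (1 - x)\<^sup>2)"
    by (simp add: k power2_commute[of x 1])
  moreover have "k - 1 = j" "k - 2 = j - 1" using k by auto
  ultimately have "(of_nat n * (x - 1) + of_nat k) * Phi k x n =
      (x * (1 - of_nat k) - of_nat k) / (x - 1) * Phi (k - 1) x n
          + x * (1 - of_nat k) / (x - 1)\<^sup>2 * Phi (k - 2) x n"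
    using Phi_recurrence[OF assms(1,2), of j] by (simp only: k mult_minus_left diff_conv_add_uminus)
  then show ?thesis using assms(4) by (simp add: eq_divide_eq mult.commute)
qed

section \<open>The series for the Charlier polynomials\<close>

text \<open>Since \<open>(k choose j) / k! = 1 / (j! (k - j)!)\<close>, this is the exponential
  series of \<open>z * v\<close> shifted by \<open>j\<close>; the terms with \<open>k < j\<close>
  vanish.\<close>

lemma exp_binomial_sums:
  fixes z v :: complex
  assumes "v \<noteq> 0"
  shows "(\<lambda>k. z ^ k / fact k * (of_nat (k choose j) * v ^ (k - j))) sums (z ^ j / fact j * exp (z * v))"
proof -
  have "(\<lambda>i. z ^ j / fact j * ((z * v) ^ i /\<^sub>R fact i)) sums (z ^ j / fact j * exp (z * v))"
    by (intro sums_mult exp_converges)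
  also have "(\<lambda>i. z ^ j / fact j * ((z * v) ^ i /\<^sub>R fact i)) =
      (\<lambda>i. z ^ (i + j) / fact (i + j) * (of_nat ((i + j) choose j) * v ^ (i + j - j)))"
    by (rule ext) (simp add: binomial_fact scaleR_conv_of_real power_add power_mult_distrib field_simps)
  finally show ?thesis
    by (subst (asm) sums_zero_iff_shift) (auto simp: binomial_eq_0)
qed

lemma Phi_series:
  assumes "x \<noteq> 1" "n > 0"
  shows "(\<lambda>k. (- a) ^ k / fact k * Phi k x n) sums (exp (- (a / (1 - x))) * charlier a (x * of_nat n) n)"
proof -
  define v where "v = 1 / (1 - x)"
  let ?g = "\<lambda>j. (of_nat n * x) gchoose (n - j)"
  have v: "v \<noteq> 0" using assms by (simp add: v_def)
  \<comment> \<open>Extending the range adds only zero binomials and makes it independent of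
    \<open>k\<close>, so the series becomes a finite sum of convergent series.\<close>
  have "Phi k x n = fact n * (\<Sum>j\<le>n. ?g j * (of_nat (k choose j) * v ^ (k - j)))" for k
  proof -
    have "(\<Sum>j\<le>min k n. of_nat (k choose j) * (1 / (1 - x) ^ (k - j)) * ?g j) =
        (\<Sum>j\<le>n. ?g j * (of_nat (k choose j) * v ^ (k - j)))"
      by (rule sum.mono_neutral_cong_left) (auto simp: v_def power_one_over binomial_eq_0)
    then show ?thesis unfolding Phi_explicit[OF assms] by simp
  qed
  then have "(\<lambda>k. (- a) ^ k / fact k * Phi k x n) =
      (\<lambda>k. \<Sum>j\<le>n. fact n * ?g j * ((- a) ^ k / fact k * (of_nat (k choose j) * v ^ (k - j))))"
    by (simp add: sum_distrib_left mult_ac)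
  moreover have "\<dots> sums (\<Sum>j\<le>n. fact n * ?g j * ((- a) ^ j / fact j * exp (- a * v)))"
    by (intro sums_sum sums_mult exp_binomial_sums v)
  moreover have "(\<Sum>j\<le>n. fact n * ?g j * ((- a) ^ j / fact j * exp (- a * v))) =
      exp (- (a / (1 - x))) * charlier a (x * of_nat n) n"
  proof -
    \<comment> \<open>Reversing the explicit sum pairs \<open>?g j\<close> with
      \<open>(- a) ^ j\<close>.\<close>
    have "charlier a (x * of_nat n) n =
        (\<Sum>j\<le>n. of_nat (n choose (n - j)) * ?g j * fact (n - j) * (- a) ^ (n - (n - j)))"
      unfolding charlier_explicit
      by (rule sum.reindex_bij_witness[of _ "\<lambda>j. n - j" "\<lambda>j. n - j"]) (auto simp: mult.commute[of x])
    also have "\<dots> = (\<Sum>j\<le>n. fact n * ?g j * ((- a) ^ j / fact j))"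
      by (intro sum.cong refl) (simp add: binomial_fact)
    finally show ?thesis
      by (simp add: sum_distrib_left v_def mult_ac)
  qed
  ultimately show ?thesis by simp
qed

section \<open>Growth in n, uniformly away from 1\<close>

lemma norm_Phi_0_le:
  assumes "x \<noteq> 1" "n > 0"
  shows "norm (Phi 0 x n) \<le> pochhammer (real n * norm x) n"
  unfolding Phi_0[OF assms] pochhammer_prod prod_norm[symmetric] atLeast0LessThan
proof (intro prod_mono conjI)
  fix i
  show "norm (of_nat n * x - of_nat i) \<le> real n * norm x + real i"
    using norm_triangle_ineq4[of "of_nat n * x" "of_nat i"] by (simp add: norm_mult)
qed auto

text \<open>The lower bound on \<open>m\<close> makes \<open>Suc j\<close> at most half of
  \<open>m * \<delta>\<close>, so the leading coefficient of the recurrence has norm at least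
  \<open>m * \<delta> / 2\<close>. Dividing by it produces \<open>2 / \<delta>\<close> and
  \<open>1 / m\<close>; the other factors bound both remaining coefficients.\<close>

lemma norm_Phi_step:
  fixes y :: complex
  assumes d: "0 < \<delta>" "\<delta> \<le> norm (y - 1)" and m: "m > 0" "2 * real (Suc j) / \<delta> \<le> real m"
  shows "norm (Phi (Suc j) y m) \<le> 2 / \<delta> * real (Suc j) * (1 + 2 / \<delta>) * (1 + 1 / \<delta>) *
    (norm (Phi j y m) + norm (Phi (j - 1) y m)) / real m"
proof -
  define r where "r = norm (y - 1)"
  have r: "r > 0" "\<delta> \<le> r" using d by (auto simp: r_def)
  have y1: "y \<noteq> 1" using d by auto
  have r': "norm (1 - y) = r" by (simp add: r_def norm_minus_commute)
  have y: "norm y \<le> r + 1" using norm_triangle_ineq[of "y - 1" 1] by (simp add: r_def)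
  have inv: "1 / r \<le> 1 / \<delta>" using d r by (simp add: frac_le)
  \<comment> \<open>This keeps the constants uniform although \<open>y\<close> is unbounded:
    \<open>norm y\<close> grows no faster than \<open>r + 1\<close>.\<close>
  have q: "norm y / r \<le> 1 + 1 / \<delta>"
  proof -
    have "norm y / r \<le> (r + 1) / r" using y r by (simp add: divide_right_mono)
    also have "\<dots> = 1 + 1 / r" using r by (simp add: add_divide_distrib)
    finally show ?thesis using inv by simp
  qed
  let ?K = "real (Suc j) * (1 + 2 / \<delta>) * (1 + 1 / \<delta>)"
  have c1: "norm ((y * of_nat j + of_nat (Suc j)) / (1 - y)) \<le> ?K"
  proof -
    have "norm (y * of_nat j + of_nat (Suc j)) \<le> norm y * real j + real (Suc j)"
      by (metis norm_mult norm_of_nat norm_triangle_ineq)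
    also have "\<dots> \<le> real (Suc j) * (norm y + 1)"
      by (simp add: algebra_simps)
    finally have "norm ((y * of_nat j + of_nat (Suc j)) / (1 - y)) \<le> real (Suc j) * (norm y + 1) / r"
      unfolding norm_divide r' using r by (intro divide_right_mono) auto
    also have "\<dots> = real (Suc j) * (norm y / r + 1 / r)"
      by (metis add_divide_distrib times_divide_eq_right)
    also have "\<dots> \<le> real (Suc j) * (1 + 2 / \<delta>)"
      using q inv by (intro mult_left_mono) auto
    also have "\<dots> \<le> ?K"
      using d mult_left_mono[of 1 "1 + 1 / \<delta>" "real (Suc j) * (1 + 2 / \<delta>)"] by simp
    finally show ?thesis .
  qed
  have c2: "norm (y * of_nat j / (1 - y)\<^sup>2) \<le> ?K"
  proof -
    have "norm (y * of_nat j / (1 - y)\<^sup>2) = real j * (1 / r) * (norm y / r)"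
      by (simp add: norm_mult norm_divide norm_power r' power2_eq_square)
    also have "\<dots> \<le> real (Suc j) * (1 + 2 / \<delta>) * (1 + 1 / \<delta>)"
    proof (intro mult_mono q)
      have "0 < 1 / \<delta>" using d by simp
      then show "1 / r \<le> 1 + 2 / \<delta>" using inv by linarith
    qed (use d r in auto)
    finally show ?thesis .
  qed
  have low: "real m * \<delta> / 2 \<le> norm (of_nat m * (y - 1) + of_nat (Suc j))"
  proof -
    have "norm (of_nat m * (y - 1)) - norm (of_nat (Suc j) :: complex) \<le>
        norm (of_nat m * (y - 1) + of_nat (Suc j))"
      by (rule norm_diff_ineq)
    moreover have "real m * \<delta> \<le> norm (of_nat m * (y - 1))"
      using d by (simp add: norm_mult mult_left_mono)
    moreover have "real (Suc j) \<le> real m * \<delta> / 2"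
      using m d by (simp add: field_simps)
    ultimately show ?thesis by (simp only: norm_of_nat)
  qed
  have "real m * \<delta> / 2 * norm (Phi (Suc j) y m) \<le>
      norm ((of_nat m * (y - 1) + of_nat (Suc j)) * Phi (Suc j) y m)"
    unfolding norm_mult using low by (intro mult_right_mono) auto
  also have "\<dots> \<le> norm ((y * of_nat j + of_nat (Suc j)) / (1 - y) * Phi j y m) +
      norm (y * of_nat j / (1 - y)\<^sup>2 * Phi (j - 1) y m)"
    unfolding Phi_recurrence[OF y1 m(1)] by (rule norm_triangle_ineq4)
  also have "\<dots> \<le> ?K * norm (Phi j y m) + ?K * norm (Phi (j - 1) y m)"
    unfolding norm_mult[of _ "Phi _ _ _"] by (intro add_mono mult_right_mono c1 c2) auto
  finally have "real m * \<delta> / 2 * norm (Phi (Suc j) y m) \<le>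
      ?K * (norm (Phi j y m) + norm (Phi (j - 1) y m))"
    by (simp only: distrib_left)
  then have "norm (Phi (Suc j) y m) \<le> ?K * (norm (Phi j y m) + norm (Phi (j - 1) y m)) / (real m * \<delta> / 2)"
    using m d by (subst pos_le_divide_eq) (auto simp: mult.commute)
  moreover have "A * S / (real m * \<delta> / 2) = 2 / \<delta> * A * S / real m" for A S
    by (simp add: mult_ac)
  ultimately show ?thesis by (simp only: mult.assoc)
qed

text \<open>The signs of \<open>C\<close> and \<open>N\<close> belong to the claim so that the
  induction can scale inequalities by \<open>C\<close> and divide by \<open>m\<close>.\<close>

lemma Phi_uniform_bound:
  assumes "0 < \<delta>"
  shows "\<exists>C\<ge>0. \<exists>N>0. \<forall>m\<ge>N. \<forall>y. norm (y - 1) \<ge> \<delta> \<longrightarrow>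
    norm (Phi k y m) \<le> C * (pochhammer (real m * norm y) m / real m ^ ((k + 1) div 2))"
proof (induction k rule: less_induct)
  case (less k)
  show ?case
  proof (cases k)
    case 0
    show ?thesis
    proof (intro exI[of _ "1::real"] exI[of _ "1::nat"] conjI allI impI)
      fix m :: nat and y :: complex assume "m \<ge> 1" "norm (y - 1) \<ge> \<delta>"
      then show "norm (Phi k y m) \<le> 1 * (pochhammer (real m * norm y) m / real m ^ ((k + 1) div 2))"
        using assms norm_Phi_0_le[of y m] by (cases "y = 1") (auto simp: 0)
    qed auto
  next
    case (Suc j)
    obtain C1 N1 where 1: "C1 \<ge> 0" "N1 > 0" "\<And>m y. m \<ge> N1 \<Longrightarrow> norm (y - 1) \<ge> \<delta> \<Longrightarrow>
        norm (Phi j y m) \<le> C1 * (pochhammer (real m * norm y) m / real m ^ ((j + 1) div 2))"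
      using less.IH[of j] Suc by blast
    obtain C2 N2 where 2: "C2 \<ge> 0" "N2 > 0" "\<And>m y. m \<ge> N2 \<Longrightarrow> norm (y - 1) \<ge> \<delta> \<Longrightarrow>
        norm (Phi (j - 1) y m) \<le> C2 * (pochhammer (real m * norm y) m / real m ^ ((j - 1 + 1) div 2))"
      using less.IH[of "j - 1"] Suc by (metis less_Suc_eq_le diff_le_self)
    define K where "K = 2 / \<delta> * real (Suc j) * (1 + 2 / \<delta>) * (1 + 1 / \<delta>)"
    define N where "N = max (max N1 N2) (nat \<lceil>2 * real (Suc j) / \<delta>\<rceil>)"
    have K: "K \<ge> 0" using assms by (simp add: K_def)
    show ?thesis
    proof (intro exI[of _ "K * (C1 + C2)"] exI[of _ N] conjI allI impI)
      show "K * (C1 + C2) \<ge> 0" "N > 0" using K 1 2 by (auto simp: N_def)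
      fix m :: nat and y :: complex assume m: "m \<ge> N" and y: "norm (y - 1) \<ge> \<delta>"
      have m': "m \<ge> N1" "m \<ge> N2" "2 * real (Suc j) / \<delta> \<le> real m" "m > 0"
        using m 1 by (auto simp: N_def simp del: of_nat_Suc)
      define P where "P = pochhammer (real m * norm y) m"
      have P: "P \<ge> 0" unfolding P_def by (intro pochhammer_real_nonneg) auto
      let ?e = "(k + 1) div 2"
      \<comment> \<open>The exponent \<open>?e\<close> exceeds that of either predecessor by at most
        1; the factor \<open>m\<close> lost here is regained from the division by \<open>m\<close>
        in \<open>norm_Phi_step\<close>. As the recurrence reaches back to \<open>k - 2\<close>, the
        exponent rises only at every second step.\<close>
      have mono: "P / real m ^ e \<le> real m * (P / real m ^ ?e)" if "?e \<le> e + 1" for e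
      proof -
        have "real m ^ ?e \<le> real m ^ (e + 1)" using that m' by (intro power_increasing) auto
        then have "P * real m ^ ?e \<le> P * real m ^ (e + 1)" using P by (intro mult_left_mono)
        then show ?thesis using m' by (simp add: field_simps)
      qed
      have "norm (Phi j y m) \<le> C1 * (real m * (P / real m ^ ?e))"
        using 1(3)[OF m'(1) y] mult_left_mono[OF mono[of "(j + 1) div 2"] 1(1)] Suc
        by (simp add: P_def)
      moreover have "norm (Phi (j - 1) y m) \<le> C2 * (real m * (P / real m ^ ?e))"
      proof -
        \<comment> \<open>For \<open>j = 0\<close> truncation gives \<open>j - 1 = 0\<close>, and
          both sides are 1.\<close>
        have "?e \<le> (j - 1 + 1) div 2 + 1" unfolding Suc by (cases j) auto
        from mult_left_mono[OF mono[OF this] 2(1)] 2(3)[OF m'(2) y] show ?thesis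
          unfolding P_def by linarith
      qed
      ultimately have "K * (norm (Phi j y m) + norm (Phi (j - 1) y m)) / real m \<le>
          K * (C1 * (real m * (P / real m ^ ?e)) + C2 * (real m * (P / real m ^ ?e))) / real m"
        using K by (intro divide_right_mono mult_left_mono add_mono) auto
      also have "\<dots> = K * (C1 + C2) * (P / real m ^ ?e)"
        using m' by (simp add: field_simps)
      finally show "norm (Phi k y m) \<le> K * (C1 + C2) * (P / real m ^ ?e)"
        using norm_Phi_step[OF assms y m'(4,3)] unfolding K_def[symmetric] Suc by linarith
    qed
  qed
qed

section \<open>The bound with the integer part as exponent, and the assembly of the claims\<close>

lemma powi_floor_half:
  "r powi (- \<lfloor>(real k + 1) / 2\<rfloor>) = 1 / r ^ ((k + 1) div 2)" for r :: real
proof -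
  have "\<lfloor>(real k + 1) / 2\<rfloor> = int ((k + 1) div 2)"
    using floor_divide_of_nat_eq[of "k + 1" 2] by (simp add: add.commute)
  then show ?thesis by (simp only: power_int_minus power_int_of_nat inverse_eq_divide)
qed

theorem theorem3p1:
  fixes x a :: complex and n :: nat
  assumes "x \<noteq> 1" and "n > 0"
  shows
    "(Phi 0 x n = (\<Prod>i<n. of_nat n * x - of_nat i)
     \<and> (of_nat n * x - of_nat n + 1 \<notin> \<int>\<^sub>\<le>\<^sub>0 \<longrightarrow>
          Phi 0 x n = Gamma (of_nat n * x + 1) / Gamma (of_nat n * x + 1 - of_nat n))
     \<and> (of_nat n * (x - 1) + 1 \<noteq> 0 \<longrightarrow>
          Phi 1 x n = Phi 0 x n / ((1 - x) * (of_nat n * (x - 1) + 1)))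
     \<and> ((\<lambda>y. Phi 0 y n / ((1 - y) * (of_nat n * (y - 1) + 1))) \<longlongrightarrow> Phi 1 x n) (at x))
     \<and> (summable (\<lambda>k. (- a) ^ k / fact k * Phi k x n)
     \<and> charlier a (x * of_nat n) n
         = exp (a / (1 - x)) * (\<Sum>k. (- a) ^ k / fact k * Phi k x n))
     \<and> (\<forall>k\<ge>2. of_nat n * (x - 1) + of_nat k \<noteq> 0 \<longrightarrow>
       Phi k x n = 1 / (of_nat n * (x - 1) + of_nat k) *
         ((x * (1 - of_nat k) - of_nat k) / (x - 1) * Phi (k - 1) x n
          + x * (1 - of_nat k) / (x - 1)\<^sup>2 * Phi (k - 2) x n))
     \<and> (\<forall>k. (\<lambda>m. norm (Phi k x m)) \<in>
       O(\<lambda>m. real m powi (- \<lfloor>(real k + 1) / 2\<rfloor>) * pochhammer (real m * norm x) m))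
     \<and> (\<forall>k. \<forall>\<delta>>0. \<exists>(C::real) N. \<forall>m\<ge>N. \<forall>y::complex. norm (y - 1) \<ge> \<delta> \<longrightarrow>
       norm (Phi k y m)
         \<le> C * (real m powi (- \<lfloor>(real k + 1) / 2\<rfloor>) * pochhammer (real m * norm y) m))"
proof -
  have uniform: "\<exists>C N. \<forall>m\<ge>N. \<forall>y::complex. norm (y - 1) \<ge> \<delta> \<longrightarrow> norm (Phi k y m)
      \<le> C * (real m powi (- \<lfloor>(real k + 1) / 2\<rfloor>) * pochhammer (real m * norm y) m)"
    if "\<delta> > 0" for k \<delta>
  proof -
    obtain C N where "\<forall>m\<ge>N. \<forall>y. norm (y - 1) \<ge> \<delta> \<longrightarrow>
        norm (Phi k y m) \<le> C * (pochhammer (real m * norm y) m / real m ^ ((k + 1) div 2))"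
      using Phi_uniform_bound[OF \<open>\<delta> > 0\<close>, of k] by blast
    then show ?thesis
      unfolding powi_floor_half by (intro exI[of _ C] exI[of _ N]) simp
  qed
  have bigo: "(\<lambda>m. norm (Phi k x m)) \<in>
      O(\<lambda>m. real m powi (- \<lfloor>(real k + 1) / 2\<rfloor>) * pochhammer (real m * norm x) m)" for k
  proof -
    \<comment> \<open>At a fixed \<open>x\<close> the positive distance \<open>norm (x - 1)\<close>
      serves as \<open>\<delta>\<close>, and \<open>y = x\<close> is admissible.\<close>
    obtain C N where "\<forall>m\<ge>N. \<forall>y::complex. norm (y - 1) \<ge> norm (x - 1) \<longrightarrow> norm (Phi k y m)
        \<le> C * (real m powi (- \<lfloor>(real k + 1) / 2\<rfloor>) * pochhammer (real m * norm y) m)"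
      using uniform[of "norm (x - 1)" k] assms(1) by auto
    moreover have "pochhammer (real m * norm x) m \<ge> 0" for m
      by (intro pochhammer_real_nonneg) auto
    ultimately show ?thesis
      by (intro bigoI[of _ C] eventually_sequentiallyI[of N]) (simp add: abs_mult)
  qed
  note series = Phi_series[OF assms, of a]
  have "charlier a (x * of_nat n) n
      = exp (a / (1 - x)) * (\<Sum>k. (- a) ^ k / fact k * Phi k x n)"
    unfolding sums_unique[OF series, symmetric] by (simp flip: mult.assoc exp_add)
  with sums_summable[OF series] uniform bigo show ?thesis
    by (intro conjI allI impI Phi_0 Phi_0_Gamma Phi_1 Phi_1_tendsto Phi_recurrence_solved assms) assumption+
qed

end
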